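(* Let $(E,d_E)$ be a complete separable metric space with Borel $\sigma$-algebra $\mathcal E$, let $\mu\in\mathcal P^2(E)$, and let $\Phi,\widetilde\Phi\colon E\to\mathbb R$ belong to $L^2_\mu(\mathbb R)$ with $\operatorname{ess\,inf}_\mu\Phi=0$. Put $Z:=\int_E e^{-\Phi}\,d\mu$ and $\widetilde Z:=\int_E e^{-\widetilde\Phi}\,d\mu$ (both in $(0,\infty)$), and define the probability measures $$\mu_\Phi(dx):=\frac1Z e^{-\Phi(x)}\,\mu(dx),\qquad \mu_{\widetilde\Phi}(dx):=\frac1{\widetilde Z}e^{-\widetilde\Phi(x)}\,\mu(dx).$$ Then $$\mathrm W_1(\mu_\Phi,\mu_{\widetilde\Phi})\le\frac{2\exp\left(-[\operatorname{ess\,inf}_\mu\widetilde\Phi]_-\right)\,|\mu|_{\mathcal P^2}}{\min(Z,\widetilde Z)^2}\,\|\Phi-\widetilde\Phi\|_{L^2_\mu}.$$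
   Context: $[t]_-:=\min(0,t)$. For a Borel probability measure $\mu$ on $E$, $|\mu|_{\mathcal P^2}:=\inf_{x_0\in E}\left(\int_E d_E^2(x,x_0)\,\mu(dx)\right)^{1/2}$, and $\mathcal P^2(E)$ is the set of $\mu$ with $|\mu|_{\mathcal P^2}<\infty$. The 1-Wasserstein distance is $\mathrm W_1(\mu,\widetilde\mu):=\inf_{\pi\in\Pi(\mu,\widetilde\mu)}\int_{E\times E}d_E(x,y)\,\pi(dx\,dy)$, where $\Pi(\mu,\widetilde\mu)$ is the set of couplings of $\mu$ and $\widetilde\mu$. $L^2_\mu(\mathbb R)$ is the space of measurable real functions that are square-integrable with respect to $\mu$. If $\operatorname{ess\,inf}_\mu\widetilde\Phi=-\infty$ the right-hand side is read as $+\infty$. *)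

theory Defs
  imports "HOL-Probability.Probability"
begin

text \<open>Dual to the library's \<^const>\<open>esssup\<close>; takes the value \<open>-\<infinity>\<close> on non-measurable functions.\<close>
definition ess_inf :: "'a measure \<Rightarrow> ('a \<Rightarrow> real) \<Rightarrow> ereal" where
  "ess_inf M f = - esssup M (\<lambda>x. - ereal (f x))"

definition L2_space :: "'a measure \<Rightarrow> ('a \<Rightarrow> real) set" where
  "L2_space M = {f \<in> borel_measurable M. integrable M (\<lambda>x. (f x)\<^sup>2)}"

definition L2_norm :: "'a measure \<Rightarrow> ('a \<Rightarrow> real) \<Rightarrow> real" where
  "L2_norm M f = sqrt (\<integral>x. (f x)\<^sup>2 \<partial>M)"

definition ennsqrt :: "ennreal \<Rightarrow> ennreal" where
  "ennsqrt t = (if t = \<infinity> then \<infinity> else ennreal (sqrt (enn2real t)))"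

definition P2_norm :: "'a::metric_space measure \<Rightarrow> ennreal" where
  "P2_norm \<mu> = (INF x0. ennsqrt (\<integral>\<^sup>+x. ennreal ((dist x x0)\<^sup>2) \<partial>\<mu>))"

definition P2_space :: "'a::metric_space measure set" where
  "P2_space = {\<mu>. prob_space \<mu> \<and> sets \<mu> = sets borel \<and> P2_norm \<mu> < \<infinity>}"

definition couplings ::
  "'a::topological_space measure \<Rightarrow> 'a measure \<Rightarrow> ('a \<times> 'a) measure set" where
  "couplings \<mu> \<nu> = {\<pi>. sets \<pi> = sets (borel \<Otimes>\<^sub>M borel) \<and>
     distr \<pi> borel fst = \<mu> \<and> distr \<pi> borel snd = \<nu>}"

definition W1 :: "'a::metric_space measure \<Rightarrow> 'a measure \<Rightarrow> ennreal" where
  "W1 \<mu> \<nu> = (INF \<pi>\<in>couplings \<mu> \<nu>. \<integral>\<^sup>+z. ennreal (dist (fst z) (snd z)) \<partial>\<pi>)"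

definition normalizer :: "'a measure \<Rightarrow> ('a \<Rightarrow> real) \<Rightarrow> ennreal" where
  "normalizer \<mu> \<Phi> = (\<integral>\<^sup>+x. ennreal (exp (- \<Phi> x)) \<partial>\<mu>)"

definition gibbs :: "'a measure \<Rightarrow> ('a \<Rightarrow> real) \<Rightarrow> 'a measure" where
  "gibbs \<mu> \<Phi> = density \<mu> (\<lambda>x. ennreal (exp (- \<Phi> x)) / normalizer \<mu> \<Phi>)"

lemma prob_space_gibbs:
  assumes [measurable]: "\<Phi> \<in> borel_measurable \<mu>"
    and "0 < normalizer \<mu> \<Phi>" "normalizer \<mu> \<Phi> < \<infinity>"
  shows "prob_space (gibbs \<mu> \<Phi>)"
proof
  have "emeasure (gibbs \<mu> \<Phi>) (space (gibbs \<mu> \<Phi>))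
      = (\<integral>\<^sup>+x. ennreal (exp (- \<Phi> x)) / normalizer \<mu> \<Phi> \<partial>\<mu>)"
    unfolding gibbs_def by (subst emeasure_density) (auto intro!: nn_integral_cong)
  also have "\<dots> = normalizer \<mu> \<Phi> / normalizer \<mu> \<Phi>"
    by (subst nn_integral_divide) (auto simp: normalizer_def)
  also have "\<dots> = 1"
    using assms by (intro ennreal_divide_self) auto
  finally show "emeasure (gibbs \<mu> \<Phi>) (space (gibbs \<mu> \<Phi>)) = 1" .
qed

end

theory Submission
  imports Defs
begin

text \<open>For densities \<open>f\<close>, \<open>g\<close> with respect to \<open>\<mu>\<close>, couple by keeping the common mass \<open>min f g\<close> on the
  diagonal and moving the excess \<open>max 0 (f - g)\<close> to the deficit \<open>max 0 (g - f)\<close> by a normalized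
  product measure. Routing every moved path through a point \<open>x0\<close> bounds the cost by
  \<open>\<integral> d(x, x0) \<bar>f - g\<bar> d\<mu>\<close>, hence by Cauchy-Schwarz by the \<open>L\<^sup>2\<close> distance of the densities. As
  \<open>exp (-t)\<close> is Lipschitz on the essential ranges of the potentials, \<open>\<bar>f - g\<bar>\<close> is almost everywhere at
  most \<open>C / min(Z, Z')\<^sup>2 (\<bar>\<Delta>\<bar> + D)\<close>, where \<open>\<Delta>\<close> is the difference of the potentials and \<open>D\<close> its
  \<open>L\<^sup>2\<close> norm; the \<open>L\<^sup>2\<close> norm of \<open>\<bar>\<Delta>\<bar> + D\<close> is at most \<open>2 D\<close>.\<close>

section \<open>Couplings of measures given by densities\<close>

text \<open>The sum of the image of \<open>density M m\<close> under the diagonal map and a weighted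
  product measure. Describing it by its integrals serves both marginals (indicators as
  \<open>\<phi>\<close>) and the transport cost (the distance as \<open>\<phi>\<close>) at
  once.\<close>

lemma ex_measure_diagonal_plus_product:
  fixes m p q :: "'a \<Rightarrow> ennreal"
  assumes "sigma_finite_measure M"
    and [measurable]: "m \<in> borel_measurable M" "p \<in> borel_measurable M" "q \<in> borel_measurable M"
  shows "\<exists>\<pi>. sets \<pi> = sets (M \<Otimes>\<^sub>M M) \<and>
    (\<forall>\<phi>\<in>borel_measurable (M \<Otimes>\<^sub>M M). (\<integral>\<^sup>+z. \<phi> z \<partial>\<pi>) =
      (\<integral>\<^sup>+x. m x * \<phi> (x, x) \<partial>M) + (\<integral>\<^sup>+x. \<integral>\<^sup>+y. p x * q y * \<phi> (x, y) \<partial>M \<partial>M))"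
proof -
  interpret M: sigma_finite_measure M by fact
  define A where "A = distr (density M m) (M \<Otimes>\<^sub>M M) (\<lambda>x. (x, x))"
  define B where "B = density (M \<Otimes>\<^sub>M M) (\<lambda>(x, y). p x * q y)"
  define \<pi> where "\<pi> = measure_of (space (M \<Otimes>\<^sub>M M)) (sets (M \<Otimes>\<^sub>M M)) (\<lambda>X. emeasure A X + emeasure B X)"
  have sA[measurable_cong]: "sets A = sets (M \<Otimes>\<^sub>M M)" by (simp add: A_def)
  have sB[measurable_cong]: "sets B = sets (M \<Otimes>\<^sub>M M)" by (simp add: B_def)
  have s\<pi>[measurable_cong]: "sets \<pi> = sets (M \<Otimes>\<^sub>M M)"
    by (simp add: \<pi>_def sets.sigma_sets_eq)
  \<comment> \<open>\<open>measure_of\<close> keeps the given set function only if it is a measure,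
    so countable additivity of the sum has to be checked.\<close>
  have em: "emeasure \<pi> X = emeasure A X + emeasure B X" if "X \<in> sets (M \<Otimes>\<^sub>M M)" for X
    unfolding \<pi>_def
  proof (rule emeasure_measure_of_sigma)
    show "sigma_algebra (space (M \<Otimes>\<^sub>M M)) (sets (M \<Otimes>\<^sub>M M))" ..
    show "positive (sets (M \<Otimes>\<^sub>M M)) (\<lambda>X. emeasure A X + emeasure B X)"
      by (simp add: positive_def)
    show "countably_additive (sets (M \<Otimes>\<^sub>M M)) (\<lambda>X. emeasure A X + emeasure B X)"
    proof (rule countably_additiveI)
      fix F :: "nat \<Rightarrow> _" assume *: "range F \<subseteq> sets (M \<Otimes>\<^sub>M M)" "disjoint_family F"
      have "(\<Sum>i. emeasure A (F i)) = emeasure A (\<Union>i. F i)"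
        "(\<Sum>i. emeasure B (F i)) = emeasure B (\<Union>i. F i)"
        using * by (auto intro!: suminf_emeasure simp: sA sB)
      then show "(\<Sum>i. emeasure A (F i) + emeasure B (F i)) = emeasure A (\<Union>i. F i) + emeasure B (\<Union>i. F i)"
        by (subst suminf_add[symmetric]) auto
    qed
  qed fact
  have sp: "space \<pi> = space (M \<Otimes>\<^sub>M M)" "space A = space (M \<Otimes>\<^sub>M M)" "space B = space (M \<Otimes>\<^sub>M M)"
    using s\<pi> sA sB by (auto dest: sets_eq_imp_space_eq)
  have int: "(\<integral>\<^sup>+z. \<phi> z \<partial>\<pi>) = (\<integral>\<^sup>+z. \<phi> z \<partial>A) + (\<integral>\<^sup>+z. \<phi> z \<partial>B)"
    if "\<phi> \<in> borel_measurable (M \<Otimes>\<^sub>M M)" for \<phi>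
    using that
  proof (induction rule: borel_measurable_induct)
    case (cong f g)
    have "integral\<^sup>N N f = integral\<^sup>N N g" if "space N = space (M \<Otimes>\<^sub>M M)" for N
      using cong that by (intro nn_integral_cong) auto
    then show ?case using cong sp by metis
  next
    case (set X)
    then show ?case by (simp add: em sA sB s\<pi>)
  next
    case (mult u c)
    then have [measurable]: "u \<in> borel_measurable (M \<Otimes>\<^sub>M M)" by simp
    show ?case using mult by (simp add: nn_integral_cmult distrib_left)
  next
    case (add u v)
    then have [measurable]: "u \<in> borel_measurable (M \<Otimes>\<^sub>M M)" "v \<in> borel_measurable (M \<Otimes>\<^sub>M M)"
      by simp_all
    show ?case using add by (simp add: nn_integral_add ac_simps)
  next
    case (seq U)
    have [measurable]: "U i \<in> borel_measurable (M \<Otimes>\<^sub>M M)" for i using seq by simp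
    have S: "(\<integral>\<^sup>+z. (SUP i. U i) z \<partial>N) = (SUP i. integral\<^sup>N N (U i))"
      if [measurable_cong]: "sets N = sets (M \<Otimes>\<^sub>M M)" for N
    proof -
      have "(\<integral>\<^sup>+z. (SUP i. U i z) \<partial>N) = (SUP i. integral\<^sup>N N (U i))"
        by (rule nn_integral_monotone_convergence_SUP) (use seq in auto)
      then show ?thesis by (simp add: image_comp SUP_apply)
    qed
    \<comment> \<open>Both sequences of integrals increase in the same index, so the sum of their
      suprema is the supremum of their sums.\<close>
    have "incseq (\<lambda>i. integral\<^sup>N N (U i))" for N
      using seq by (auto simp: incseq_def le_fun_def intro!: nn_integral_mono)
    then show ?case
      unfolding S[OF s\<pi>] S[OF sA] S[OF sB] using seq by (simp add: ennreal_SUP_add)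
  qed
  show ?thesis
  proof (intro exI[of _ \<pi>] conjI ballI s\<pi>)
    fix \<phi> :: "_ \<Rightarrow> ennreal" assume [measurable]: "\<phi> \<in> borel_measurable (M \<Otimes>\<^sub>M M)"
    have "(\<integral>\<^sup>+z. \<phi> z \<partial>A) = (\<integral>\<^sup>+x. m x * \<phi> (x, x) \<partial>M)"
      unfolding A_def by (subst nn_integral_distr) (auto simp: nn_integral_density)
    moreover have "(\<integral>\<^sup>+z. \<phi> z \<partial>B) = (\<integral>\<^sup>+x. \<integral>\<^sup>+y. p x * q y * \<phi> (x, y) \<partial>M \<partial>M)"
      unfolding B_def
      by (subst nn_integral_density, simp, simp, subst M.nn_integral_fst[symmetric]) auto
    ultimately show "(\<integral>\<^sup>+z. \<phi> z \<partial>\<pi>) = (\<integral>\<^sup>+x. m x * \<phi> (x, x) \<partial>M)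
      + (\<integral>\<^sup>+x. \<integral>\<^sup>+y. p x * q y * \<phi> (x, y) \<partial>M \<partial>M)"
      by (simp add: int)
  qed
qed

text \<open>The diagonal part of the coupling costs nothing. In the product part the detour through
  \<open>x0\<close> separates the variables, which leaves the distance to \<open>x0\<close>
  integrated against excess plus deficit, that is, against \<open>\<bar>f - g\<bar>\<close>. The
  point \<open>x0\<close> stays free so that an infimum over it can be taken later.\<close>

lemma W1_density_le:
  fixes M :: "'a::{metric_space, second_countable_topology} measure" and f g :: "'a \<Rightarrow> real"
  assumes "sigma_finite_measure M" and sets[measurable_cong]: "sets M = sets borel"
    and f[measurable]: "f \<in> borel_measurable M" and g[measurable]: "g \<in> borel_measurable M"
    and nn: "\<And>x. 0 \<le> f x" "\<And>x. 0 \<le> g x"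
    and mass: "(\<integral>\<^sup>+x. f x \<partial>M) = (\<integral>\<^sup>+x. g x \<partial>M)" "(\<integral>\<^sup>+x. f x \<partial>M) < \<infinity>"
  shows "W1 (density M f) (density M g) \<le> (\<integral>\<^sup>+x. ennreal (dist x x0) * ennreal \<bar>f x - g x\<bar> \<partial>M)"
proof -
  interpret M: sigma_finite_measure M by fact
  define m where "m x = ennreal (min (f x) (g x))" for x
  \<comment> \<open>\<open>ennreal\<close> sends negative reals to 0, so \<open>p\<close> and
    \<open>q\<close> are the positive parts of \<open>f - g\<close> and
    \<open>g - f\<close>.\<close>
  define p where "p x = ennreal (f x - g x)" for x
  define q where "q x = ennreal (g x - f x)" for x
  define \<delta> where "\<delta> = (\<integral>\<^sup>+x. p x \<partial>M)"
  have [measurable]: "m \<in> borel_measurable M" "p \<in> borel_measurable M" "q \<in> borel_measurable M"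
    unfolding m_def p_def q_def by measurable
  have mp: "m x + p x = f x" and mq: "m x + q x = g x" and pq: "p x + q x = ennreal \<bar>f x - g x\<bar>" for x
    using nn[of x]
    by (cases "f x \<le> g x"; simp add: m_def p_def q_def min_def ennreal_neg flip: ennreal_plus)+
  \<comment> \<open>Cancelling the common mass, which is finite, shows that excess and deficit have
    the same mass \<open>\<delta>\<close>.\<close>
  have "(\<integral>\<^sup>+x. m x \<partial>M) + (\<integral>\<^sup>+x. p x \<partial>M) = (\<integral>\<^sup>+x. m x \<partial>M) + (\<integral>\<^sup>+x. q x \<partial>M)"
    using mass by (simp add: nn_integral_add[symmetric] mp mq)
  moreover have m_fin: "(\<integral>\<^sup>+x. m x \<partial>M) < \<infinity>"
    by (rule le_less_trans[OF nn_integral_mono mass(2)]) (simp add: m_def ennreal_leI)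
  ultimately have \<delta>_q: "(\<integral>\<^sup>+x. q x \<partial>M) = \<delta>"
    by (auto simp: \<delta>_def ennreal_add_left_cancel)
  have "\<delta> \<le> (\<integral>\<^sup>+x. f x \<partial>M)"
    unfolding \<delta>_def using nn by (intro nn_integral_mono) (simp add: p_def ennreal_leI)
  then have \<delta>_fin: "\<delta> < \<infinity>" using mass(2) by (rule le_less_trans)
  \<comment> \<open>In \<open>ennreal\<close> the quotient 0 / 0 is 0, so
    \<open>\<delta> / \<delta>\<close> is 1 only for nonzero \<open>\<delta>\<close>. If
    \<open>\<delta>\<close> is 0, then \<open>u\<close> vanishes almost everywhere and both sides
    are 0; the coupling thus needs no separate degenerate case.\<close>
  have cancel: "(\<delta> / \<delta>) * (\<integral>\<^sup>+x. u x * indicator A x \<partial>M) = (\<integral>\<^sup>+x. u x * indicator A x \<partial>M)"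
    if [measurable]: "u \<in> borel_measurable M" and u: "(\<integral>\<^sup>+x. u x \<partial>M) = \<delta>" for u A
  proof (cases "\<delta> = 0")
    case True
    then have "AE x in M. u x = 0" using u by (simp add: nn_integral_0_iff_AE)
    then have "(\<integral>\<^sup>+x. u x * indicator A x \<partial>M) = (\<integral>\<^sup>+x. 0 \<partial>M)"
      by (intro nn_integral_cong_AE) auto
    then show ?thesis by simp
  qed (use \<delta>_fin in simp)
  obtain \<pi> where \<pi>[measurable_cong]: "sets \<pi> = sets (M \<Otimes>\<^sub>M M)"
    and int: "\<And>\<phi>. \<phi> \<in> borel_measurable (M \<Otimes>\<^sub>M M) \<Longrightarrow> (\<integral>\<^sup>+z. \<phi> z \<partial>\<pi>) =
      (\<integral>\<^sup>+x. m x * \<phi> (x, x) \<partial>M) + (\<integral>\<^sup>+x. \<integral>\<^sup>+y. p x * (q y / \<delta>) * \<phi> (x, y) \<partial>M \<partial>M)"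
    using ex_measure_diagonal_plus_product[of M m p "\<lambda>y. q y / \<delta>"] assms(1) by auto
  \<comment> \<open>The integrand separates. With \<open>a\<close> or \<open>b\<close> constantly 1
    this yields each marginal of the product part and each half of the cost.\<close>
  have product: "(\<integral>\<^sup>+x. \<integral>\<^sup>+y. p x * (q y / \<delta>) * (a x * b y) \<partial>M \<partial>M) =
      (\<integral>\<^sup>+x. p x * a x \<partial>M) * ((\<integral>\<^sup>+y. q y * b y \<partial>M) / \<delta>)"
    if [measurable]: "a \<in> borel_measurable M" "b \<in> borel_measurable M" for a b :: "'a \<Rightarrow> ennreal"
  proof -
    have "(\<integral>\<^sup>+x. \<integral>\<^sup>+y. p x * (q y / \<delta>) * (a x * b y) \<partial>M \<partial>M)
        = (\<integral>\<^sup>+x. \<integral>\<^sup>+y. (p x * a x) * (q y * b y / \<delta>) \<partial>M \<partial>M)"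
      by (simp add: divide_ennreal_def ac_simps)
    then show ?thesis
      by (simp add: nn_integral_cmult nn_integral_multc nn_integral_divide)
  qed
  have fst_marginal: "distr \<pi> borel fst = density M f"
  proof (rule measure_eqI)
    fix A assume "A \<in> sets (distr \<pi> borel fst)"
    then have A[measurable]: "A \<in> sets borel" "A \<in> sets M" by (simp_all add: sets)
    have "emeasure (distr \<pi> borel fst) A = (\<integral>\<^sup>+z. indicator A (fst z) \<partial>\<pi>)"
      by (subst nn_integral_distr[symmetric, of fst \<pi> borel]) simp_all
    also have "\<dots> = (\<integral>\<^sup>+x. m x * indicator A x \<partial>M) + (\<delta> / \<delta>) * (\<integral>\<^sup>+x. p x * indicator A x \<partial>M)"
      by (subst int, measurable) (use product[of "indicator A" "\<lambda>_. 1"] in \<open>simp add: \<delta>_q mult.commute\<close>)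
    also have "(\<delta> / \<delta>) * (\<integral>\<^sup>+x. p x * indicator A x \<partial>M) = (\<integral>\<^sup>+x. p x * indicator A x \<partial>M)"
      by (rule cancel) (simp_all add: \<delta>_def)
    also have "(\<integral>\<^sup>+x. m x * indicator A x \<partial>M) + \<dots> = (\<integral>\<^sup>+x. ennreal (f x) * indicator A x \<partial>M)"
      by (subst nn_integral_add[symmetric], simp, simp, simp only: distrib_right[symmetric] mp)
    also have "\<dots> = emeasure (density M f) A"
      by (rule emeasure_density[symmetric]) simp_all
    finally show "emeasure (distr \<pi> borel fst) A = emeasure (density M f) A" .
  qed (simp add: sets)
  have snd_marginal: "distr \<pi> borel snd = density M g"
  proof (rule measure_eqI)
    fix A assume "A \<in> sets (distr \<pi> borel snd)"
    then have A[measurable]: "A \<in> sets borel" "A \<in> sets M" by (simp_all add: sets)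
    have "emeasure (distr \<pi> borel snd) A = (\<integral>\<^sup>+z. indicator A (snd z) \<partial>\<pi>)"
      by (subst nn_integral_distr[symmetric, of snd \<pi> borel]) simp_all
    also have "\<dots> = (\<integral>\<^sup>+x. m x * indicator A x \<partial>M) + (\<delta> / \<delta>) * (\<integral>\<^sup>+x. q x * indicator A x \<partial>M)"
      by (subst int, measurable)
        (use product[of "\<lambda>_. 1" "indicator A"] in \<open>simp add: \<delta>_def[symmetric] divide_ennreal_def ac_simps\<close>)
    also have "(\<delta> / \<delta>) * (\<integral>\<^sup>+x. q x * indicator A x \<partial>M) = (\<integral>\<^sup>+x. q x * indicator A x \<partial>M)"
      by (rule cancel) (simp_all add: \<delta>_q)
    also have "(\<integral>\<^sup>+x. m x * indicator A x \<partial>M) + \<dots> = (\<integral>\<^sup>+x. ennreal (g x) * indicator A x \<partial>M)"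
      by (subst nn_integral_add[symmetric], simp, simp, simp only: distrib_right[symmetric] mq)
    also have "\<dots> = emeasure (density M g) A"
      by (rule emeasure_density[symmetric]) simp_all
    finally show "emeasure (distr \<pi> borel snd) A = emeasure (density M g) A" .
  qed (simp add: sets)
  have \<pi>_borel: "sets \<pi> = sets (borel \<Otimes>\<^sub>M borel)"
    unfolding \<pi> by (intro sets_pair_measure_cong sets)
  have "W1 (density M f) (density M g) \<le> (\<integral>\<^sup>+z. ennreal (dist (fst z) (snd z)) \<partial>\<pi>)"
    unfolding W1_def using \<pi>_borel fst_marginal snd_marginal
    by (intro INF_lower) (simp add: couplings_def)
  also have "\<dots> = (\<integral>\<^sup>+x. \<integral>\<^sup>+y. p x * (q y / \<delta>) * ennreal (dist x y) \<partial>M \<partial>M)"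
    by (subst int) (auto intro!: measurable_compose[OF _ measurable_ennreal])
  \<comment> \<open>Triangle inequality through \<open>x0\<close>; the factors 1 bring both terms
    into the shape of \<open>product\<close>.\<close>
  also have "\<dots> \<le> (\<integral>\<^sup>+x. \<integral>\<^sup>+y. p x * (q y / \<delta>) * (ennreal (dist x x0) * 1)
      + p x * (q y / \<delta>) * (1 * ennreal (dist y x0)) \<partial>M \<partial>M)"
    by (intro nn_integral_mono)
      (auto simp flip: distrib_left ennreal_plus intro!: mult_left_mono ennreal_leI dist_triangle2)
  also have "\<dots> = (\<integral>\<^sup>+x. p x * ennreal (dist x x0) \<partial>M) * (\<delta> / \<delta>)
      + (\<delta> / \<delta>) * (\<integral>\<^sup>+y. q y * ennreal (dist y x0) \<partial>M)"
    using product[of "\<lambda>x. ennreal (dist x x0)" "\<lambda>_. 1"] product[of "\<lambda>_. 1" "\<lambda>y. ennreal (dist y x0)"]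
    by (simp add: nn_integral_add \<delta>_q \<delta>_def[symmetric] divide_ennreal_def ac_simps)
  \<comment> \<open>Only an inequality, because \<open>\<delta> / \<delta>\<close> may be 0.\<close>
  also have "\<dots> \<le> (\<integral>\<^sup>+x. p x * ennreal (dist x x0) \<partial>M) * 1 + 1 * (\<integral>\<^sup>+y. q y * ennreal (dist y x0) \<partial>M)"
    using \<delta>_fin by (intro add_mono mult_mono) (cases "\<delta> = 0"; simp)+
  also have "\<dots> = (\<integral>\<^sup>+x. ennreal (dist x x0) * ennreal \<bar>f x - g x\<bar> \<partial>M)"
    by (simp add: nn_integral_add[symmetric] distrib_right[symmetric] pq mult.commute)
  finally show ?thesis .
qed


section \<open>Square roots and infima of extended nonnegative reals\<close>

text \<open>Extracts the root from the squared form of the Cauchy-Schwarz inequality. In the case of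
  0 times infinity the right-hand side is 0, but so is the bound on the square of
  \<open>x\<close>.\<close>

lemma le_ennsqrt_mult:
  assumes "x\<^sup>2 \<le> a * b"
  shows "x \<le> ennsqrt a * ennsqrt b"
proof (cases "a = \<infinity> \<or> b = \<infinity>")
  case True
  then show ?thesis
    using assms by (auto simp: ennsqrt_def ennreal_mult_top ennreal_top_mult enn2real_eq_0_iff split: if_splits)
next
  case False
  then obtain r s where rs: "a = ennreal r" "0 \<le> r" "b = ennreal s" "0 \<le> s"
    by (metis ennreal_cases infinity_ennreal_def)
  show ?thesis
  proof (cases x)
    case (real t)
    then have "t\<^sup>2 \<le> r * s"
      using assms rs by (simp add: ennreal_power ennreal_mult[symmetric])
    then show ?thesis
      using rs real
      by (simp add: ennsqrt_def ennreal_mult[symmetric] real_sqrt_mult[symmetric] real_le_rsqrt ennreal_leI)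
  next
    case top
    then show ?thesis using assms rs by (simp add: ennreal_mult[symmetric] top_unique power2_eq_square)
  qed
qed

lemma ennsqrt_le:
  assumes "t \<le> ennreal (K\<^sup>2)" "0 \<le> K"
  shows "ennsqrt t \<le> ennreal K"
proof -
  have "sqrt (enn2real t) \<le> K"
    using assms enn2real_leI[of "K\<^sup>2" t] by (simp add: real_le_lsqrt)
  moreover have "t \<noteq> \<infinity>" using assms(1) by (auto simp: top_unique)
  ultimately show ?thesis by (simp add: ennsqrt_def ennreal_leI)
qed

text \<open>A positive finite factor can be inverted and moved to the other side. For
  \<open>K = 0\<close> some index is needed to conclude that \<open>x\<close> is 0, since the
  infimum over the empty set is infinite and its product with 0 is 0.\<close>

lemma le_mult_INF_ennreal:
  fixes f :: "'i \<Rightarrow> ennreal"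
  assumes "0 \<le> K" and le: "\<And>i. i \<in> I \<Longrightarrow> x \<le> ennreal K * f i" and "I \<noteq> {}"
  shows "x \<le> ennreal K * (INF i\<in>I. f i)"
proof (cases "K = 0")
  case True
  then show ?thesis using le \<open>I \<noteq> {}\<close> by auto
next
  case False
  then have K: "ennreal K * inverse (ennreal K) = 1"
    using \<open>0 \<le> K\<close> by (simp add: divide_ennreal_def[symmetric])
  have "inverse (ennreal K) * x \<le> f i" if "i \<in> I" for i
  proof -
    have "inverse (ennreal K) * x \<le> inverse (ennreal K) * (ennreal K * f i)"
      by (intro mult_left_mono le that) simp
    also have "\<dots> = f i" using K by (simp add: mult.assoc[symmetric] mult.commute)
    finally show ?thesis .
  qed
  then have "ennreal K * (inverse (ennreal K) * x) \<le> ennreal K * (INF i\<in>I. f i)"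
    by (intro mult_left_mono INF_greatest) simp_all
  then show ?thesis using K by (simp add: mult.assoc[symmetric])
qed

section \<open>Essential infimum, square integrability and normalizers\<close>

lemma ess_inf_AE: "AE x in M. ess_inf M f \<le> ereal (f x)"
  using esssup_AE[of "\<lambda>x. - ereal (f x)" M]
  by (auto simp: ess_inf_def ereal_uminus_le_reorder elim!: eventually_mono)

lemma L2_space_diff:
  assumes "f \<in> L2_space M" "g \<in> L2_space M"
  shows "(\<lambda>x. f x - g x) \<in> L2_space M"
proof -
  have [measurable]: "f \<in> borel_measurable M" "g \<in> borel_measurable M"
    and int: "integrable M (\<lambda>x. (f x)\<^sup>2)" "integrable M (\<lambda>x. (g x)\<^sup>2)"
    using assms by (auto simp: L2_space_def)
  have "integrable M (\<lambda>x. (f x - g x)\<^sup>2)"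
  proof (rule Bochner_Integration.integrable_bound)
    show "integrable M (\<lambda>x. 2 * (f x)\<^sup>2 + 2 * (g x)\<^sup>2)" using int by simp
    have "(a - b)\<^sup>2 \<le> 2 * a\<^sup>2 + 2 * b\<^sup>2" for a b :: real
      using zero_le_power2[of "a + b"] by (simp add: power2_eq_square algebra_simps)
    then show "AE x in M. norm ((f x - g x)\<^sup>2) \<le> norm (2 * (f x)\<^sup>2 + 2 * (g x)\<^sup>2)" by simp
  qed simp
  then show ?thesis by (simp add: L2_space_def)
qed

text \<open>The bound is nonnegativity of the variance of \<open>\<bar>f\<bar>\<close>.\<close>

lemma (in prob_space)
  assumes "f \<in> L2_space M"
  shows L2_space_imp_integrable: "integrable M f"
    and integral_abs_le_L2_norm: "(\<integral>x. \<bar>f x\<bar> \<partial>M) \<le> L2_norm M f"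
proof -
  have [measurable]: "f \<in> borel_measurable M" and sq: "integrable M (\<lambda>x. (f x)\<^sup>2)"
    using assms by (auto simp: L2_space_def)
  show int: "integrable M f" by (rule square_integrable_imp_integrable) (use sq in simp_all)
  have "(\<integral>x. \<bar>f x\<bar> \<partial>M)\<^sup>2 \<le> (\<integral>x. (f x)\<^sup>2 \<partial>M)"
    using variance_eq[of "\<lambda>x. \<bar>f x\<bar>"] variance_positive[of "\<lambda>x. \<bar>f x\<bar>"] int sq by simp
  then show "(\<integral>x. \<bar>f x\<bar> \<partial>M) \<le> L2_norm M f"
    unfolding L2_norm_def by (rule real_le_rsqrt)
qed

text \<open>A vanishing integral would force the exponential to be 0 almost everywhere. The value
  infinity is allowed, so this also covers potentials that are essentially unbounded below.\<close>

lemma (in prob_space) normalizer_pos: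
  assumes [measurable]: "\<Phi> \<in> borel_measurable M"
  shows "0 < normalizer M \<Phi>"
proof (rule ccontr)
  assume "\<not> 0 < normalizer M \<Phi>"
  then have "AE x in M. ennreal (exp (- \<Phi> x)) = 0"
    by (subst nn_integral_0_iff_AE[symmetric]) (auto simp: normalizer_def)
  then show False by simp
qed

text \<open>Passes from the extended normalizer to a positive real number, so that the estimates on
  densities can be made in the reals.\<close>

lemma (in prob_space)
  assumes [measurable]: "\<Phi> \<in> borel_measurable M" and "AE x in M. exp (- \<Phi> x) \<le> C"
  shows integrable_exp_minus: "integrable M (\<lambda>x. exp (- \<Phi> x))"
    and normalizer_eq_integral: "normalizer M \<Phi> = ennreal (\<integral>x. exp (- \<Phi> x) \<partial>M)"
    and integral_exp_minus_pos: "0 < (\<integral>x. exp (- \<Phi> x) \<partial>M)"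
proof -
  show int: "integrable M (\<lambda>x. exp (- \<Phi> x))"
    by (rule integrable_const_bound[where B=C]) (use assms in auto)
  show eq: "normalizer M \<Phi> = ennreal (\<integral>x. exp (- \<Phi> x) \<partial>M)"
    unfolding normalizer_def by (rule nn_integral_eq_integral[OF int]) simp
  show "0 < (\<integral>x. exp (- \<Phi> x) \<partial>M)"
    using normalizer_pos[of \<Phi>] by (simp add: eq)
qed

lemma gibbs_eq_density:
  assumes "normalizer M \<Phi> = ennreal Z" "0 < Z"
  shows "gibbs M \<Phi> = density M (\<lambda>x. ennreal (exp (- \<Phi> x) / Z))"
  using assms by (simp add: gibbs_def divide_ennreal)

section \<open>Pointwise estimates for normalized exponentials\<close>

text \<open>For \<open>a \<le> b\<close>, factor out the larger value \<open>exp (- a)\<close> and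
  apply \<open>1 + t \<le> exp t\<close> with \<open>t = a - b\<close>.\<close>

lemma abs_exp_minus_diff_le:
  fixes a b :: real
  assumes "exp (- a) \<le> C" "exp (- b) \<le> C"
  shows "\<bar>exp (- a) - exp (- b)\<bar> \<le> C * \<bar>a - b\<bar>"
  using assms
proof (induction a b rule: linorder_wlog)
  case (le a b)
  have "exp (- a) - exp (- b) = exp (- a) * (1 - exp (a - b))"
    by (simp add: right_diff_distrib exp_add[symmetric])
  also have "\<dots> \<le> exp (- a) * (b - a)"
    using exp_ge_add_one_self[of "a - b"] by (intro mult_left_mono) (linarith, simp)
  also have "\<dots> \<le> C * (b - a)"
    using le by (intro mult_right_mono) auto
  finally show ?case using le by simp
qed (simp add: abs_minus_commute)

lemma abs_normalized_diff_le:
  fixes e e' Z Z' C D t :: real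
  assumes "0 < Z" "Z \<le> 1" "0 < Z'" "0 \<le> e" "e \<le> 1"
    and "\<bar>e - e'\<bar> \<le> C * t" "\<bar>Z - Z'\<bar> \<le> C * D"
  shows "\<bar>e / Z - e' / Z'\<bar> \<le> C / (min Z Z')\<^sup>2 * (t + D)"
proof -
  let ?r = "(min Z Z')\<^sup>2"
  \<comment> \<open>Thanks to \<open>Z \<le> 1\<close>, the squared minimum is below both
    denominators that occur, \<open>Z'\<close> and \<open>Z * Z'\<close>.\<close>
  have "?r \<le> 1 * Z'" "?r \<le> Z * Z'" "0 < ?r"
    unfolding power2_eq_square using assms by (intro mult_mono mult_pos_pos; simp)+
  note r = this
  have nn: "0 \<le> C * t" "0 \<le> C * D" using assms by linarith+
  \<comment> \<open>The difference of the normalizers is paired with \<open>e\<close>, which is at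
    most 1, and not with \<open>e'\<close>; hence \<open>C\<close> enters to the first power
    only.\<close>
  have "e / Z - e' / Z' = (e - e') / Z' + e * (Z' - Z) / (Z * Z')"
    using assms by (simp add: field_simps)
  also have "\<bar>\<dots>\<bar> \<le> \<bar>e - e'\<bar> / Z' + e * \<bar>Z - Z'\<bar> / (Z * Z')"
    using abs_triangle_ineq[of "(e - e') / Z'" "e * (Z' - Z) / (Z * Z')"] assms
    by (simp add: abs_mult abs_minus_commute)
  also have "\<dots> \<le> C * t / ?r + 1 * (C * D) / ?r"
    using assms r nn by (intro add_mono frac_le mult_mono) auto
  finally show ?thesis by (simp add: distrib_left add_divide_distrib)
qed

section \<open>Wasserstein stability of Gibbs measures\<close>

text \<open>The essential infima enter only through the almost sure bounds 1 and \<open>C\<close> on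
  the exponentials. By \<open>1 \<le> C\<close> the larger bound \<open>C\<close> holds for both,
  which makes it a Lipschitz constant.\<close>

lemma W1_gibbs_le:
  fixes M :: "'a::{metric_space, second_countable_topology} measure"
  assumes "prob_space M" and sets: "sets M = sets borel"
    and L2: "\<Phi> \<in> L2_space M" "\<Phi>' \<in> L2_space M"
    and ae: "AE x in M. exp (- \<Phi> x) \<le> 1" and ae': "AE x in M. exp (- \<Phi>' x) \<le> C" and "1 \<le> C"
  shows "W1 (gibbs M \<Phi>) (gibbs M \<Phi>') \<le> ennreal (2 * C) * P2_norm M
    / (min (normalizer M \<Phi>) (normalizer M \<Phi>'))\<^sup>2 * ennreal (L2_norm M (\<lambda>x. \<Phi> x - \<Phi>' x))"
proof -
  interpret prob_space M by fact
  define \<Delta> where "\<Delta> x = \<Phi> x - \<Phi>' x" for x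
  define D where "D = L2_norm M \<Delta>"
  define Z where "Z = (\<integral>x. exp (- \<Phi> x) \<partial>M)"
  define Z' where "Z' = (\<integral>x. exp (- \<Phi>' x) \<partial>M)"
  define f where "f x = exp (- \<Phi> x) / Z" for x
  define g where "g x = exp (- \<Phi>' x) / Z'" for x
  define B where "B = C / (min Z Z')\<^sup>2"
  have \<Phi>[measurable]: "\<Phi> \<in> borel_measurable M" and \<Phi>'[measurable]: "\<Phi>' \<in> borel_measurable M"
    using L2 by (auto simp: L2_space_def)
  have \<Delta>: "\<Delta> \<in> L2_space M" unfolding \<Delta>_def by (rule L2_space_diff[OF L2])
  then have [measurable]: "\<Delta> \<in> borel_measurable M" and \<Delta>_sq: "integrable M (\<lambda>x. (\<Delta> x)\<^sup>2)"
    by (auto simp: L2_space_def)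
  have D2: "(\<integral>x. (\<Delta> x)\<^sup>2 \<partial>M) = D\<^sup>2" and "0 \<le> D" by (simp_all add: D_def L2_norm_def)
  note exp_int = integrable_exp_minus[OF \<Phi> ae] integrable_exp_minus[OF \<Phi>' ae']
  have nZ: "normalizer M \<Phi> = ennreal Z" "normalizer M \<Phi>' = ennreal Z'" "0 < Z" "0 < Z'"
    unfolding Z_def Z'_def
    using normalizer_eq_integral[OF \<Phi> ae] normalizer_eq_integral[OF \<Phi>' ae']
      integral_exp_minus_pos[OF \<Phi> ae] integral_exp_minus_pos[OF \<Phi>' ae'] by simp_all
  have "Z \<le> (\<integral>x. 1 \<partial>M)"
    unfolding Z_def by (rule integral_mono_AE) (use exp_int ae in auto)
  then have "Z \<le> 1" by (simp add: prob_space)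
  have "0 \<le> B" using \<open>1 \<le> C\<close> by (simp add: B_def)
  have lip: "AE x in M. \<bar>exp (- \<Phi> x) - exp (- \<Phi>' x)\<bar> \<le> C * \<bar>\<Delta> x\<bar>"
    using ae ae'
  proof eventually_elim
    case (elim x)
    then show ?case unfolding \<Delta>_def using \<open>1 \<le> C\<close> by (intro abs_exp_minus_diff_le) linarith+
  qed
  \<comment> \<open>The Lipschitz bound is integrated, and the mean of
    \<open>\<bar>\<Delta>\<bar>\<close> is at most its \<open>L\<^sup>2\<close> norm
    \<open>D\<close>.\<close>
  have "Z - Z' = (\<integral>x. exp (- \<Phi> x) - exp (- \<Phi>' x) \<partial>M)"
    unfolding Z_def Z'_def using exp_int by simp
  then have "\<bar>Z - Z'\<bar> \<le> (\<integral>x. \<bar>exp (- \<Phi> x) - exp (- \<Phi>' x)\<bar> \<partial>M)"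
    by (simp only: integral_abs_bound)
  also have "\<dots> \<le> (\<integral>x. C * \<bar>\<Delta> x\<bar> \<partial>M)"
    using exp_int lip L2_space_imp_integrable[OF \<Delta>] by (intro integral_mono_AE) auto
  also have "\<dots> \<le> C * D"
    using integral_abs_le_L2_norm[OF \<Delta>] \<open>1 \<le> C\<close> by (simp add: D_def)
  finally have ZZ': "\<bar>Z - Z'\<bar> \<le> C * D" .
  have fg: "AE x in M. \<bar>f x - g x\<bar> \<le> B * (\<bar>\<Delta> x\<bar> + D)"
    using lip ae
  proof eventually_elim
    case (elim x)
    then show ?case
      unfolding f_def g_def B_def using nZ \<open>Z \<le> 1\<close> ZZ' by (intro abs_normalized_diff_le) auto
  qed
  have [measurable]: "f \<in> borel_measurable M" "g \<in> borel_measurable M"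
    unfolding f_def g_def by measurable
  have "(\<integral>\<^sup>+x. (ennreal \<bar>f x - g x\<bar>)\<^sup>2 \<partial>M) \<le> (\<integral>\<^sup>+x. ennreal (2 * B\<^sup>2 * ((\<Delta> x)\<^sup>2 + D\<^sup>2)) \<partial>M)"
  proof (rule nn_integral_mono_AE, use fg in eventually_elim)
    case (elim x)
    have "\<bar>f x - g x\<bar>\<^sup>2 \<le> (B * (\<bar>\<Delta> x\<bar> + D))\<^sup>2" using elim by (rule power_mono) simp
    \<comment> \<open>From \<open>(s + D)\<^sup>2 \<le> 2 * (s\<^sup>2 + D\<^sup>2)\<close>.\<close>
    also have "\<dots> \<le> B\<^sup>2 * (2 * ((\<Delta> x)\<^sup>2 + D\<^sup>2))"
      using zero_le_power2[of "\<bar>\<Delta> x\<bar> - D"]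
      unfolding power_mult_distrib by (intro mult_left_mono) (simp_all add: power2_sum power2_diff)
    also have "\<dots> = 2 * B\<^sup>2 * ((\<Delta> x)\<^sup>2 + D\<^sup>2)" by simp
    finally show ?case by (simp only: ennreal_power abs_ge_zero ennreal_leI)
  qed
  also have "\<dots> = ennreal (\<integral>x. 2 * B\<^sup>2 * ((\<Delta> x)\<^sup>2 + D\<^sup>2) \<partial>M)"
    by (rule nn_integral_eq_integral) (use \<Delta>_sq in auto)
  \<comment> \<open>Source of the factor 2 in the final bound: \<open>(\<Delta> x)\<^sup>2\<close>
    and the constant \<open>D\<^sup>2\<close> each integrate to \<open>D\<^sup>2\<close>.\<close>
  also have "(\<integral>x. 2 * B\<^sup>2 * ((\<Delta> x)\<^sup>2 + D\<^sup>2) \<partial>M) = (2 * B * D)\<^sup>2"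
    using \<Delta>_sq by (simp add: D2 prob_space power_mult_distrib)
  finally have L2_fg: "(\<integral>\<^sup>+x. (ennreal \<bar>f x - g x\<bar>)\<^sup>2 \<partial>M) \<le> ennreal ((2 * B * D)\<^sup>2)" .
  have mass: "(\<integral>\<^sup>+x. f x \<partial>M) = 1" "(\<integral>\<^sup>+x. g x \<partial>M) = 1"
    unfolding f_def g_def
    by (subst nn_integral_eq_integral; use exp_int nZ in \<open>simp add: Z_def[symmetric] Z'_def[symmetric]\<close>)+
  have "W1 (gibbs M \<Phi>) (gibbs M \<Phi>') \<le> ennreal (2 * B * D) * ennsqrt (\<integral>\<^sup>+x. ennreal ((dist x x0)\<^sup>2) \<partial>M)"
    for x0
  proof -
    have [measurable]: "(\<lambda>x. ennreal (dist x x0)) \<in> borel_measurable M"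
      using sets by (simp cong: measurable_cong_sets)
    have "W1 (gibbs M \<Phi>) (gibbs M \<Phi>') = W1 (density M f) (density M g)"
      using nZ by (simp add: gibbs_eq_density f_def g_def)
    also have "\<dots> \<le> (\<integral>\<^sup>+x. ennreal (dist x x0) * ennreal \<bar>f x - g x\<bar> \<partial>M)"
      using nZ mass
      by (intro W1_density_le) (simp_all add: sigma_finite_measure_axioms sets f_def[of x for x] g_def[of x for x])
    also have "\<dots> \<le> ennsqrt (\<integral>\<^sup>+x. (ennreal (dist x x0))\<^sup>2 \<partial>M) * ennsqrt (\<integral>\<^sup>+x. (ennreal \<bar>f x - g x\<bar>)\<^sup>2 \<partial>M)"
      by (intro le_ennsqrt_mult Cauchy_Schwarz_nn_integral) measurable
    also have "\<dots> \<le> ennsqrt (\<integral>\<^sup>+x. (ennreal (dist x x0))\<^sup>2 \<partial>M) * ennreal (2 * B * D)"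
      using \<open>0 \<le> B\<close> \<open>0 \<le> D\<close> by (intro mult_left_mono ennsqrt_le L2_fg) simp_all
    finally show ?thesis by (simp add: ennreal_power mult.commute)
  qed
  \<comment> \<open>The constant does not depend on \<open>x0\<close>, so the infimum over
    \<open>x0\<close> may be taken.\<close>
  then have "W1 (gibbs M \<Phi>) (gibbs M \<Phi>') \<le> ennreal (2 * B * D) * P2_norm M"
    unfolding P2_norm_def using \<open>0 \<le> B\<close> \<open>0 \<le> D\<close> by (intro le_mult_INF_ennreal) auto
  also have "ennreal (2 * B * D) = ennreal (2 * C) / ennreal ((min Z Z')\<^sup>2) * ennreal D"
    using nZ \<open>1 \<le> C\<close> \<open>0 \<le> D\<close> by (simp add: B_def divide_ennreal ennreal_mult[symmetric])
  also have "\<dots> * P2_norm M = ennreal (2 * C) * P2_norm M / ennreal ((min Z Z')\<^sup>2) * ennreal D"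
    by (simp add: divide_ennreal_def ac_simps)
  also have "ennreal ((min Z Z')\<^sup>2) = (min (normalizer M \<Phi>) (normalizer M \<Phi>'))\<^sup>2"
    using nZ by (simp add: ennreal_power[symmetric] min_def)
  finally show ?thesis by (simp add: D_def \<Delta>_def[abs_def])
qed

text \<open>The exponential of a square-integrable function may fail to be integrable, so the second
  normalizer is claimed finite only when \<open>\<Phi>'\<close> is essentially bounded below. In
  that case \<open>min 0\<close> also rules out infinity, and \<open>real_of_ereal\<close> is
  applied to a finite value.\<close>

theorem mainTheorem7:
  fixes \<mu> :: "'a::{complete_space, second_countable_topology} measure"
    and \<Phi> \<Phi>' :: "'a \<Rightarrow> real"
  assumes "\<mu> \<in> P2_space"
    and "\<Phi> \<in> L2_space \<mu>" and "\<Phi>' \<in> L2_space \<mu>"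
    and "ess_inf \<mu> \<Phi> = 0"
  shows "0 < normalizer \<mu> \<Phi> \<and> normalizer \<mu> \<Phi> < \<infinity> \<and>
    0 < normalizer \<mu> \<Phi>' \<and> (ess_inf \<mu> \<Phi>' \<noteq> -\<infinity> \<longrightarrow> normalizer \<mu> \<Phi>' < \<infinity>) \<and>
    W1 (gibbs \<mu> \<Phi>) (gibbs \<mu> \<Phi>') \<le>
      (if ess_inf \<mu> \<Phi>' = -\<infinity> then \<infinity>
       else ennreal (2 * exp (- real_of_ereal (min 0 (ess_inf \<mu> \<Phi>')))) * P2_norm \<mu>
              / (min (normalizer \<mu> \<Phi>) (normalizer \<mu> \<Phi>'))\<^sup>2
            * ennreal (L2_norm \<mu> (\<lambda>x. \<Phi> x - \<Phi>' x)))"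
proof -
  have \<mu>: "prob_space \<mu>" "sets \<mu> = sets borel"
    using assms(1) by (auto simp: P2_space_def)
  interpret prob_space \<mu> by fact
  have \<Phi>: "\<Phi> \<in> borel_measurable \<mu>" and \<Phi>': "\<Phi>' \<in> borel_measurable \<mu>"
    using assms by (auto simp: L2_space_def)
  have ae: "AE x in \<mu>. exp (- \<Phi> x) \<le> 1"
    using ess_inf_AE[of \<mu> \<Phi>] assms(4) by (auto simp: zero_ereal_def elim!: eventually_mono)
  define C where "C = exp (- real_of_ereal (min 0 (ess_inf \<mu> \<Phi>')))"
  \<comment> \<open>If the essential infimum is \<open>-\<infinity>\<close>, then
    \<open>real_of_ereal\<close> gives 0 and \<open>C\<close> is 1; the inequality therefore holds
    unconditionally, unlike \<open>ae'\<close>.\<close>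
  have "1 \<le> C"
    unfolding C_def by (cases "ess_inf \<mu> \<Phi>'") (auto simp: min_def zero_ereal_def)
  have ae': "AE x in \<mu>. exp (- \<Phi>' x) \<le> C" if "ess_inf \<mu> \<Phi>' \<noteq> -\<infinity>"
    using ess_inf_AE[of \<mu> \<Phi>']
  proof eventually_elim
    case (elim x)
    then show ?case
      using that unfolding C_def by (cases "ess_inf \<mu> \<Phi>'") (auto simp: min_def zero_ereal_def)
  qed
  show ?thesis
    using normalizer_pos[OF \<Phi>] normalizer_pos[OF \<Phi>'] normalizer_eq_integral[OF \<Phi> ae]
      normalizer_eq_integral[OF \<Phi>' ae'] W1_gibbs_le[OF \<mu> assms(2,3) ae ae' \<open>1 \<le> C\<close>]
    by (auto simp flip: C_def)
qed

end
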